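(* Let $\mathcal{F}$ be a finite family of convex sets in $\mathbb{R}^d$. If the intersection of every $\frac{d(d+3)}{2}$ or fewer sets in $\mathcal{F}$ contains an ellipsoid whose sum of lengths of principal axes is equal to one, then $\bigcap \mathcal{F}$ contains an ellipsoid whose sum of lengths of principal axes is equal to one.
   Context: An ellipsoid in $\mathbb{R}^d$ is the image of the Euclidean unit ball under an invertible affine map; its principal axes are the $d$ axes of symmetry, whose lengths are the full axis lengths. *)

theory Defs
  imports "HOL-Analysis.Analysis"
begin

definition ellipsoid :: "(real^'n) set \<Rightarrow> bool" where
  "ellipsoid E \<longleftrightarrow>
     (\<exists>(A :: real^'n^'n) c. invertible A \<and> E = (\<lambda>x. A *v x + c) ` cball 0 1)"

definition axis_line :: "real^'n \<Rightarrow> real^'n \<Rightarrow> (real^'n) set" where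
  "axis_line c u = range (\<lambda>t. c + t *\<^sub>R u)"

text \<open>For a unit vector \<open>u\<close>: the isometry that fixes the line \<open>axis_line c u\<close> pointwise
  and acts as \<open>-1\<close> on the directions orthogonal to \<open>u\<close>.\<close>

definition reflect_axis :: "real^'n \<Rightarrow> real^'n \<Rightarrow> real^'n \<Rightarrow> real^'n" where
  "reflect_axis c u x = c + (2 * ((x - c) \<bullet> u)) *\<^sub>R u - (x - c)"

definition axis_of_symmetry :: "(real^'n) set \<Rightarrow> real^'n \<Rightarrow> real^'n \<Rightarrow> bool" where
  "axis_of_symmetry E c u \<longleftrightarrow> norm u = 1 \<and> reflect_axis c u ` E = E"

text \<open>A system of principal axes consists of one axis of symmetry per dimension, concurrent
  in \<open>c\<close> and pairwise orthogonal. Orthogonality matters only if some axis lengths coincide,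
  since \<open>E\<close> then has infinitely many axes of symmetry.\<close>

definition principal_axes :: "(real^'n) set \<Rightarrow> real^'n \<Rightarrow> ('n \<Rightarrow> real^'n) \<Rightarrow> bool" where
  "principal_axes E c u \<longleftrightarrow>
     (\<forall>i. axis_of_symmetry E c (u i)) \<and> (\<forall>i j. i \<noteq> j \<longrightarrow> u i \<bullet> u j = 0)"

definition axis_length :: "(real^'n) set \<Rightarrow> real^'n \<Rightarrow> real^'n \<Rightarrow> real" where
  "axis_length E c u = diameter (E \<inter> axis_line c u)"

text \<open>For an ellipsoid the sum does not depend on the chosen system: the directions form an
  orthonormal eigenbasis of \<open>A A\<^sup>T\<close>, where \<open>A\<close> is the linear part of a defining affine map, and
  the lengths are twice the square roots of the eigenvalues.\<close>

definition has_axis_length_sum :: "(real^'n) set \<Rightarrow> real \<Rightarrow> bool" where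
  "has_axis_length_sum E s \<longleftrightarrow>
     (\<exists>c u. principal_axes E c u \<and> (\<Sum>i\<in>UNIV. axis_length E c (u i)) = s)"

end

theory Submission
  imports Defs
begin

text \<open>
  An ellipsoid whose axis lengths sum to \<open>s\<close> is the image of the unit ball under \<open>x \<mapsto> A x + c\<close> for
  a symmetric positive definite \<open>A\<close> of trace \<open>s / 2\<close>, because the eigenvalues of \<open>A\<close> are the
  semi-axes. These pairs \<open>(A, c)\<close> form a convex set in an affine space of dimension
  \<open>d (d + 1) / 2 - 1 + d = d (d + 3) / 2 - 1\<close>, and for convex \<open>K\<close> the pairs whose ellipsoid lies in
  \<open>K\<close> form a convex subset. Helly's theorem in this affine space gives the claim.
\<close>

section \<open>Helly's theorem in an affine subspace\<close>

text \<open>Radon's argument by induction on the number of indices. A bound \<open>m\<close> above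
  the affine dimension of \<open>S\<close> takes the place of the usual ambient dimension plus one.
  The sets are indexed, so repetitions are allowed.\<close>

lemma Helly_aff_dim:
  fixes S :: "'a::euclidean_space set" and C :: "'i \<Rightarrow> 'a set"
  assumes "finite I" "convex S" "aff_dim S < int m"
    and "\<And>i. i \<in> I \<Longrightarrow> convex (C i)"
    and "\<And>J. J \<subseteq> I \<Longrightarrow> card J \<le> m \<Longrightarrow> \<exists>p\<in>S. \<forall>i\<in>J. p \<in> C i"
  shows "\<exists>p\<in>S. \<forall>i\<in>I. p \<in> C i"
  using assms
proof (induction "card I" arbitrary: I rule: less_induct)
  case less
  show ?case
  proof (cases "card I \<le> m")
    case True
    then show ?thesis using less.prems(5) by blast
  next
    case False
    \<comment> \<open>By induction, dropping any single index leaves a common point;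
      \<open>x i\<close> will be such a point for the dropped index \<open>i\<close>.\<close>
    have "\<exists>p\<in>S. \<forall>j\<in>I - {i}. p \<in> C j" if "i \<in> I" for i
    proof (rule less.hyps)
      show "card (I - {i}) < card I"
        using that less.prems(1) by (meson card_Diff1_less)
      show "\<exists>p\<in>S. \<forall>j\<in>J. p \<in> C j" if "J \<subseteq> I - {i}" "card J \<le> m" for J
        using less.prems(5) that by blast
    qed (use less.prems in auto)
    then obtain x where x: "\<And>i. i \<in> I \<Longrightarrow> x i \<in> S"
      "\<And>i j. i \<in> I \<Longrightarrow> j \<in> I \<Longrightarrow> j \<noteq> i \<Longrightarrow> x i \<in> C j"
      by (metis DiffI singletonD)
    show ?thesis
    proof (cases "inj_on x I")
      case False
      then obtain i j where ij: "i \<in> I" "j \<in> I" "i \<noteq> j" "x i = x j"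
        by (auto simp: inj_on_def)
      \<comment> \<open>A point chosen for two different dropped indices misses no set: each index
        differs from one of the two.\<close>
      then have "x i \<in> C k" if "k \<in> I" for k
        using x(2) that by metis
      then show ?thesis using x(1) ij by blast
    next
      case True
      have "aff_dim (x ` I) \<le> aff_dim S"
        using x(1) by (intro aff_dim_subset) auto
      \<comment> \<open>More than \<open>m\<close> distinct points have \<open>card - 1\<close> at
        least \<open>m\<close>, which exceeds the affine dimension available in
        \<open>S\<close>.\<close>
      then have "aff_dim (x ` I) \<noteq> int (card (x ` I)) - 1"
        using \<open>\<not> card I \<le> m\<close> less.prems(3) by (simp add: card_image True)
      then have "affine_dependent (x ` I)"
        using affine_independent_iff_card by blast
      then obtain M P where MP: "M \<subseteq> x ` I" "P \<subseteq> x ` I" "M \<inter> P = {}"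
        "convex hull M \<inter> convex hull P \<noteq> {}"
        using Radon by metis
      then obtain p where p: "p \<in> convex hull M" "p \<in> convex hull P" by blast
      have "p \<in> C i" if i: "i \<in> I" for i
      proof -
        \<comment> \<open>Only \<open>x i\<close> may fail to lie in \<open>C i\<close>. As
          \<open>M\<close> and \<open>P\<close> are disjoint, one of them avoids \<open>x i\<close>,
          so its hull, which contains \<open>p\<close>, lies in \<open>C i\<close>.\<close>
        have *: "p \<in> C i" if "p \<in> convex hull Q" "Q \<subseteq> x ` I" "x i \<notin> Q" for Q
        proof -
          have "Q \<subseteq> C i" using that x(2) i by auto
          then show ?thesis using that(1) less.prems(4)[OF i] hull_minimal[of Q "C i" convex] by blast
        qed
        show ?thesis using * p MP by blast
      qed
      moreover have "p \<in> S"
        using p(1) MP(1) x(1) less.prems(2) hull_minimal[of M S convex] by blast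
      ultimately show ?thesis by blast
    qed
  qed
qed

section \<open>The dimension of the parameter space\<close>

text \<open>An explicit spanning set is counted: \<open>n\<close> diagonal matrices,
  \<open>n choose 2\<close> off-diagonal ones and \<open>n\<close> unit vectors for the
  centre.\<close>

lemma dim_symmetric_times_le:
  "dim {(A :: real^'n^'n, c :: real^'n). transpose A = A} \<le> CARD('n) * (CARD('n) + 3) div 2"
proof -
  \<comment> \<open>Singletons stand for diagonal positions and doubletons for pairs of mirrored
    off-diagonal ones; indexing by unordered pairs makes the matrix in \<open>s X\<close> symmetric
    by construction.\<close>
  define P :: "'n set set" where "P = {X. card X = 1} \<union> {X. card X = 2}"
  define s :: "'n set \<Rightarrow> (real^'n^'n) \<times> (real^'n)"
    where "s X = (\<chi> i j. if {i, j} = X then 1 else 0, 0)" for X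
  define e :: "'n \<Rightarrow> (real^'n^'n) \<times> (real^'n)" where "e i = (0, axis i 1)" for i
  let ?W = "s ` P \<union> range e"
  have inP: "{i, j} \<in> P" for i j :: 'n
    by (cases "i = j") (auto simp: P_def)
  have card1: "card {X::'n set. card X = k} = CARD('n) choose k" for k
    using n_subsets[of "UNIV::'n set" k] by simp
  have "card P \<le> CARD('n) + (CARD('n) choose 2)"
    unfolding P_def using card_Un_le[of "{X::'n set. card X = 1}" "{X. card X = 2}"]
    by (simp add: card1[of 1, simplified] card1)
  moreover have "card ?W \<le> card P + CARD('n)"
    using card_Un_le[of "s ` P" "range e"] card_image_le[of P s] card_image_le[of UNIV e] by simp
  ultimately have "card ?W \<le> 2 * CARD('n) + (CARD('n) choose 2)" by simp
  also have "\<dots> = CARD('n) * (CARD('n) + 3) div 2"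
  proof -
    have "n * (n + 3) = n * (n - 1) + 2 * (2 * n)" for n :: nat
      by (cases n) (auto simp: algebra_simps)
    then show ?thesis by (simp add: choose_two)
  qed
  finally have card: "card ?W \<le> CARD('n) * (CARD('n) + 3) div 2" .
  have "{(A, c). transpose A = A} \<subseteq> span ?W"
  proof safe
    fix A :: "real^'n^'n" and c :: "real^'n"
    assume A: "transpose A = A"
    have sym: "A $ i $ j = A $ j $ i" for i j
      using A by (metis transpose_def vec_lambda_beta)
    \<comment> \<open>Symmetry makes an entry a function of the unordered pair of its indices; its
      values are the coefficients.\<close>
    have "\<exists>g. \<forall>i j. X = {i, j} \<longrightarrow> A $ i $ j = g" for X
      using sym by (metis doubleton_eq_iff)
    then obtain g where g: "\<And>i j. A $ i $ j = g {i, j}" by metis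
    have "fst (\<Sum>X\<in>P. g X *\<^sub>R s X) = A"
    proof -
      have "fst (\<Sum>X\<in>P. g X *\<^sub>R s X) $ i $ j = A $ i $ j" for i j
      proof -
        have "fst (\<Sum>X\<in>P. g X *\<^sub>R s X) $ i $ j = (\<Sum>X\<in>P. if {i, j} = X then g X else 0)"
          unfolding fst_sum sum_component by (intro sum.cong) (auto simp: s_def)
        also have "\<dots> = g {i, j}" by (simp only: sum.delta[OF finite] sum.delta'[OF finite] inP if_True)
        finally show ?thesis by (simp only: g)
      qed
      then show ?thesis by (simp add: vec_eq_iff)
    qed
    moreover have "snd (\<Sum>X\<in>P. g X *\<^sub>R s X) = 0"
      by (simp add: snd_sum s_def)
    moreover have "fst (\<Sum>i\<in>UNIV. c $ i *\<^sub>R e i) = 0"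
      by (simp add: fst_sum e_def)
    moreover have "snd (\<Sum>i\<in>UNIV. c $ i *\<^sub>R e i) = c"
      using basis_expansion[of c] by (simp add: snd_sum e_def scalar_mult_eq_scaleR)
    ultimately have "(A, c) = (\<Sum>X\<in>P. g X *\<^sub>R s X) + (\<Sum>i\<in>UNIV. c $ i *\<^sub>R e i)"
      by (simp add: prod_eq_iff)
    also have "\<dots> \<in> span ?W"
      by (intro span_add span_sum span_scale span_base) auto
    finally show "(A, c) \<in> span ?W" .
  qed
  then have "dim {(A :: real^'n^'n, c :: real^'n). transpose A = A} \<le> card ?W"
    by (rule dim_le_card) (auto intro: finite_subset[OF subset_UNIV])
  with card show ?thesis by linarith
qed

text \<open>The trace is the inner product with the identity matrix, so fixing it at a nonzero value
  cuts the subspace by a hyperplane that misses the origin and costs one dimension.\<close>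

lemma aff_dim_symmetric_trace_less:
  assumes "t \<noteq> 0"
  shows "aff_dim {(A :: real^'n^'n, c :: real^'n). transpose A = A \<and> trace A = t}
    < int (CARD('n) * (CARD('n) + 3) div 2)"
proof -
  let ?V = "{(A :: real^'n^'n, c :: real^'n). transpose A = A}"
  let ?H = "{x. (mat 1 :: real^'n^'n, 0 :: real^'n) \<bullet> x = t}"
  have "mat 1 \<bullet> A = trace A" for A :: "real^'n^'n"
    by (simp add: inner_vec_def trace_def mat_def if_distrib cong: if_cong)
       (simp add: if_distribR sum.delta if_distrib cong: if_cong)
  then have eq: "{(A :: real^'n^'n, c :: real^'n). transpose A = A \<and> trace A = t} = ?V \<inter> ?H"
    by auto
  have sub: "subspace ?V"
    by (auto simp: subspace_def zero_prod_def transpose_def vec_eq_iff)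
  have "(0 :: (real^'n^'n) \<times> (real^'n)) \<in> ?V" "0 \<notin> ?H"
    using subspace_0[OF sub] assms by auto
  then have "\<not> ?V \<subseteq> ?H" by (meson subsetD)
  \<comment> \<open>The value \<open>-1\<close> is the affine dimension of the empty set and covers
    an empty intersection.\<close>
  then have "aff_dim (?V \<inter> ?H) \<le> max (- 1) (aff_dim ?V - 1)"
    using aff_dim_affine_Int_hyperplane[OF subspace_imp_affine[OF sub]] by auto
  also have "aff_dim ?V = int (dim ?V)"
    by (rule aff_dim_subspace[OF sub])
  finally have "aff_dim (?V \<inter> ?H) \<le> max (- 1) (int (dim ?V) - 1)" .
  moreover have "1 \<le> CARD('n) * (CARD('n) + 3) div 2"
  proof -
    have "1 * (1 + 3) \<le> CARD('n) * (CARD('n) + 3)"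
      by (intro mult_le_mono) (auto simp: Suc_le_eq)
    then show ?thesis by simp
  qed
  moreover note dim_symmetric_times_le[where 'n = 'n]
  ultimately show ?thesis unfolding eq by linarith
qed

section \<open>Orthonormal bases and the spectral theorem\<close>

text \<open>Indexing by the coordinate type itself makes such a family an orthonormal basis.\<close>

definition orthonormal_family :: "('n \<Rightarrow> real^'n) \<Rightarrow> bool" where
  "orthonormal_family u \<longleftrightarrow> (\<forall>i j. u i \<bullet> u j = (if i = j then 1 else 0))"

text \<open>A square matrix with orthonormal rows also has orthonormal columns, since a right
  inverse is a left inverse.\<close>

lemma orthonormal_family_columns:
  assumes "orthonormal_family u"
  shows "(\<Sum>i\<in>UNIV. u i $ j * u i $ k) = (if j = k then 1 else 0)"
proof -
  define P where "P = (\<chi> i. u i)"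
  have "P ** transpose P = mat 1"
    using assms by (simp add: P_def orthonormal_family_def matrix_matrix_mult_def transpose_def
        mat_def inner_vec_def vec_eq_iff)
  then have "transpose P ** P = mat 1"
    using matrix_left_right_inverse by blast
  then have "(transpose P ** P) $ j $ k = mat 1 $ j $ k" by simp
  then show ?thesis
    by (simp add: P_def matrix_matrix_mult_def transpose_def mat_def)
qed

lemma orthonormal_family_expand:
  assumes "orthonormal_family u"
  shows "(\<Sum>i\<in>UNIV. (x \<bullet> u i) *\<^sub>R u i) = x"
proof -
  have "(\<Sum>i\<in>UNIV. (x \<bullet> u i) *\<^sub>R u i) $ k = x $ k" for k
  proof -
    have "(\<Sum>i\<in>UNIV. (x \<bullet> u i) *\<^sub>R u i) $ k = (\<Sum>i\<in>UNIV. \<Sum>j\<in>UNIV. x $ j * (u i $ j * u i $ k))"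
      by (simp add: inner_vec_def sum_distrib_right mult.assoc)
    also have "\<dots> = (\<Sum>j\<in>UNIV. x $ j * (\<Sum>i\<in>UNIV. u i $ j * u i $ k))"
      by (subst sum.swap) (simp add: sum_distrib_left)
    also have "\<dots> = x $ k"
      by (simp add: orthonormal_family_columns[OF assms] if_distrib cong: if_cong)
    finally show ?thesis .
  qed
  then show ?thesis by (simp add: vec_eq_iff)
qed

lemma orthonormal_family_inner_sum:
  assumes "orthonormal_family u"
  shows "(\<Sum>i\<in>UNIV. b i *\<^sub>R u i) \<bullet> u j = b j"
proof -
  have "(\<Sum>i\<in>UNIV. b i *\<^sub>R u i) \<bullet> u j = (\<Sum>i\<in>UNIV. if i = j then b i else 0)"
    unfolding inner_sum_left using assms by (intro sum.cong) (auto simp: orthonormal_family_def)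
  then show ?thesis by simp
qed

lemma orthonormal_family_norm_sum:
  assumes "orthonormal_family u"
  shows "(norm (\<Sum>i\<in>UNIV. b i *\<^sub>R u i))\<^sup>2 = (\<Sum>i\<in>UNIV. (b i)\<^sup>2)"
  unfolding power2_norm_eq_inner
  by (subst inner_sum_right) (simp add: orthonormal_family_inner_sum[OF assms] power2_eq_square)

text \<open>Basis independence of the trace. It turns the sum of the semi-axes into a linear
  function of the matrix.\<close>

lemma trace_orthonormal_family:
  assumes "orthonormal_family u"
  shows "(\<Sum>i\<in>UNIV. (A *v u i) \<bullet> u i) = trace (A :: real^'n^'n)"
proof -
  have "(\<Sum>i\<in>UNIV. (A *v u i) \<bullet> u i)
      = (\<Sum>i\<in>UNIV. \<Sum>j\<in>UNIV. \<Sum>k\<in>UNIV. A $ j $ k * (u i $ j * u i $ k))"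
    by (simp add: inner_vec_def matrix_vector_mult_def sum_distrib_right sum_distrib_left mult_ac)
  also have "\<dots> = (\<Sum>j\<in>UNIV. \<Sum>i\<in>UNIV. \<Sum>k\<in>UNIV. A $ j $ k * (u i $ j * u i $ k))"
    by (rule sum.swap)
  also have "\<dots> = (\<Sum>j\<in>UNIV. \<Sum>k\<in>UNIV. A $ j $ k * (\<Sum>i\<in>UNIV. u i $ j * u i $ k))"
    unfolding sum_distrib_left by (rule sum.cong[OF refl sum.swap])
  also have "\<dots> = trace A"
    by (simp add: orthonormal_family_columns[OF assms] trace_def if_distrib cong: if_cong)
  finally show ?thesis .
qed

lemma symmetric_matrix_inner:
  assumes "transpose A = (A :: real^'n^'n)"
  shows "(A *v x) \<bullet> y = x \<bullet> (A *v y)"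
  by (metis assms dot_lmul_matrix transpose_matrix_vector)

text \<open>A maximiser of the quadratic form of \<open>A\<close> on the compact unit sphere of
  \<open>W\<close> is an eigenvector. Invariance keeps the residual \<open>r\<close> inside
  \<open>W\<close>, where it is an admissible direction of variation.\<close>

lemma symmetric_eigenvector_in_subspace:
  fixes A :: "real^'n^'n"
  assumes A: "transpose A = A" and W: "subspace W" "W \<noteq> {0}"
    and inv: "\<And>x. x \<in> W \<Longrightarrow> A *v x \<in> W"
  obtains v l where "v \<in> W" "norm v = 1" "A *v v = l *\<^sub>R v"
proof -
  obtain w where w: "w \<in> W" "w \<noteq> 0" using W subspace_0 by blast
  let ?K = "W \<inter> sphere 0 1"
  have "compact ?K"
    using closed_subspace[OF W(1)] by (simp add: closed_Int_compact)
  moreover have "(1 / norm w) *\<^sub>R w \<in> ?K"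
    using w W by (auto simp: subspace_scale)
  moreover have "continuous_on ?K (\<lambda>x. x \<bullet> (A *v x))"
    by (intro continuous_intros)
  ultimately obtain v where v: "v \<in> ?K" and max: "\<And>y. y \<in> ?K \<Longrightarrow> y \<bullet> (A *v y) \<le> v \<bullet> (A *v v)"
    using continuous_attains_sup[of ?K "\<lambda>x. x \<bullet> (A *v x)"] by blast
  define l where "l = v \<bullet> (A *v v)"
  have nonneg: "0 \<le> l * (y \<bullet> y) - y \<bullet> (A *v y)" if "y \<in> W" for y
  proof (cases "y = 0")
    case False
    have "(1 / norm y) *\<^sub>R y \<in> ?K"
      using that False W by (auto simp: subspace_scale)
    from max[OF this] have "(y \<bullet> (A *v y)) / (norm y)\<^sup>2 \<le> l"
      by (simp add: l_def matrix_vector_mult_scaleR power2_eq_square)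
    then show ?thesis
      using False by (simp add: divide_le_eq power2_norm_eq_inner)
  qed simp
  define r where "r = l *\<^sub>R v - A *v v"
  have r: "r \<in> W"
    using v W inv by (auto simp: r_def intro: subspace_diff subspace_scale)
  have vv: "v \<bullet> v = 1" using v by (simp add: dot_square_norm)
  \<comment> \<open>First-order optimality: the form \<open>l |y|\<^sup>2 - y \<bullet> A y\<close> is nonnegative on \<open>W\<close> and vanishes at \<open>v\<close>,
      so its linear term at \<open>v\<close> in the direction \<open>r\<close>, which is \<open>2 |r|\<^sup>2\<close>, must be zero.\<close>
  define q where "q = l * (r \<bullet> r) - r \<bullet> (A *v r)"
  have expand: "0 \<le> 2 * t * (r \<bullet> r) + t\<^sup>2 * q" for t
  proof -
    have "v + t *\<^sub>R r \<in> W"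
      using v r W by (auto intro: subspace_add subspace_scale)
    from nonneg[OF this]
    have "0 \<le> l * ((v + t *\<^sub>R r) \<bullet> (v + t *\<^sub>R r)) - (v + t *\<^sub>R r) \<bullet> (A *v (v + t *\<^sub>R r))" .
    also have "\<dots> = l * (v \<bullet> v) - v \<bullet> (A *v v) + 2 * t * (l * (v \<bullet> r) - (A *v v) \<bullet> r) + t\<^sup>2 * q"
      using symmetric_matrix_inner[OF A, of v r]
      by (simp add: q_def matrix_vector_right_distrib matrix_vector_mult_scaleR inner_add_left
          inner_add_right inner_commute power2_eq_square algebra_simps)
    also have "l * (v \<bullet> r) - (A *v v) \<bullet> r = r \<bullet> r"
      by (subst (3) r_def) (simp add: inner_diff_left)
    finally show ?thesis by (simp add: vv l_def)
  qed
  have "r \<bullet> r = 0"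
  proof (rule ccontr)
    assume "r \<bullet> r \<noteq> 0"
    then have pos: "r \<bullet> r > 0" by simp
    \<comment> \<open>A negative \<open>t\<close> so small that the quadratic contribution
      \<open>t * q\<close> cannot outweigh the linear one,
      \<open>2 * (r \<bullet> r)\<close>.\<close>
    define t where "t = - (r \<bullet> r) / (\<bar>q\<bar> + 1)"
    have t: "t < 0" using pos by (simp add: t_def divide_neg_pos)
    have "0 \<le> t * (2 * (r \<bullet> r) + t * q)"
      using expand[of t] by (simp add: power2_eq_square algebra_simps)
    then have "2 * (r \<bullet> r) + t * q \<le> 0"
      using t by (simp add: zero_le_mult_iff)
    moreover have "\<bar>t * q\<bar> \<le> r \<bullet> r"
    proof -
      have "\<bar>t * q\<bar> = (r \<bullet> r) * (\<bar>q\<bar> / (\<bar>q\<bar> + 1))"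
        using pos by (simp add: t_def abs_mult)
      also have "\<dots> \<le> (r \<bullet> r) * 1"
        using pos by (intro mult_left_mono) auto
      finally show ?thesis by simp
    qed
    ultimately show False using pos by linarith
  qed
  then have "A *v v = l *\<^sub>R v" by (simp add: r_def)
  with v show ?thesis using that by auto
qed

text \<open>Induction over the index set: the eigenvectors found so far span a proper subspace, and
  its orthogonal complement supplies the next one.\<close>

lemma spectral_theorem_symmetric:
  fixes A :: "real^'n^'n"
  assumes A: "transpose A = A"
  obtains u l where "orthonormal_family u" "\<And>i. A *v u i = l i *\<^sub>R u i"
proof -
  have "\<exists>u l. (\<forall>i\<in>I. \<forall>j\<in>I. u i \<bullet> u j = (if i = j then 1 else 0)) \<and> (\<forall>i\<in>I. A *v u i = l i *\<^sub>R u i)"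
    for I :: "'n set"
  proof (induction I rule: finite_induct[OF finite])
    case 1
    then show ?case by simp
  next
    case (2 k I)
    then obtain u l where u: "\<And>i j. i \<in> I \<Longrightarrow> j \<in> I \<Longrightarrow> u i \<bullet> u j = (if i = j then 1 else 0)"
      and l: "\<And>i. i \<in> I \<Longrightarrow> A *v u i = l i *\<^sub>R u i" by blast
    define W where "W = {x. \<forall>i\<in>I. x \<bullet> u i = 0}"
    have "subspace W"
      by (auto simp: W_def subspace_def inner_add_left)
    moreover have "W \<noteq> {0}"
    proof -
      have "dim (span (u ` I)) \<le> card I"
        using dim_le_card'[of "u ` I"] card_image_le[of I u] by simp
      also have "\<dots> < CARD('n)"
        using 2 by (intro psubset_card_mono) auto
      finally have "span (u ` I) \<noteq> UNIV"
        by (metis dim_UNIV DIM_cart DIM_real mult.right_neutral less_irrefl)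
      then obtain a where a: "a \<noteq> 0" "\<forall>x\<in>span (u ` I). a \<bullet> x = 0"
        using span_not_UNIV_orthogonal by blast
      then have "a \<in> W" by (auto simp: W_def span_base)
      with a show ?thesis by auto
    qed
    \<comment> \<open>Symmetry shifts \<open>A\<close> onto the eigenvector \<open>u i\<close>,
      where it only scales.\<close>
    moreover have "A *v x \<in> W" if "x \<in> W" for x
      using that by (simp add: W_def symmetric_matrix_inner[OF A] l)
    ultimately obtain v m where v: "v \<in> W" "norm v = 1" "A *v v = m *\<^sub>R v"
      using symmetric_eigenvector_in_subspace[OF A] by metis
    have "\<forall>i\<in>insert k I. \<forall>j\<in>insert k I. (u(k := v)) i \<bullet> (u(k := v)) j = (if i = j then 1 else 0)"
      using v u \<open>k \<notin> I\<close> by (auto simp: W_def inner_commute norm_eq_1)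
    moreover have "\<forall>i\<in>insert k I. A *v (u(k := v)) i = (l(k := m)) i *\<^sub>R (u(k := v)) i"
      using v l \<open>k \<notin> I\<close> by auto
    ultimately show ?case by blast
  qed
  from this[of UNIV] show ?thesis
    using that by (auto simp: orthonormal_family_def)
qed

section \<open>Ellipsoids in terms of their axes\<close>

text \<open>The numbers \<open>a i\<close> play the role of semi-axes, that is, of half axis
  lengths.\<close>

definition axes_ellipsoid :: "real^'n \<Rightarrow> ('n \<Rightarrow> real^'n) \<Rightarrow> ('n \<Rightarrow> real) \<Rightarrow> (real^'n) set" where
  "axes_ellipsoid c u a = {x. (\<Sum>i\<in>UNIV. (((x - c) \<bullet> u i) / a i)\<^sup>2) \<le> 1}"

text \<open>In the coordinates given by \<open>u\<close> the matrix scales the coordinate of index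
  \<open>i\<close> by \<open>a i\<close>, and the norm is the Euclidean norm of the
  coordinates.\<close>

lemma image_cball_eq_axes_ellipsoid:
  fixes A :: "real^'n^'n"
  assumes u: "orthonormal_family u" and a: "\<And>i. a i > 0"
    and A: "\<And>x. A *v x = (\<Sum>i\<in>UNIV. (a i * (x \<bullet> u i)) *\<^sub>R u i)"
  shows "(\<lambda>x. A *v x + c) ` cball 0 1 = axes_ellipsoid c u a"
proof -
  have Au: "(A *v x) \<bullet> u i = a i * (x \<bullet> u i)" for x i
    by (simp add: A orthonormal_family_inner_sum[OF u])
  have norm: "(norm x)\<^sup>2 = (\<Sum>i\<in>UNIV. (x \<bullet> u i)\<^sup>2)" for x
    using orthonormal_family_norm_sum[OF u, of "\<lambda>i. x \<bullet> u i"]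
    by (simp add: orthonormal_family_expand[OF u])
  have le1: "norm x \<le> 1 \<longleftrightarrow> (norm x)\<^sup>2 \<le> 1" for x :: "real^'n"
    by (simp add: abs_square_le_1)
  have a0: "a i \<noteq> 0" for i using a[of i] by simp
  show ?thesis
  proof safe
    fix x :: "real^'n" assume "x \<in> cball 0 1"
    then show "A *v x + c \<in> axes_ellipsoid c u a"
      by (simp add: axes_ellipsoid_def Au le1 norm a0)
  next
    fix y assume y: "y \<in> axes_ellipsoid c u a"
    define x where "x = (\<Sum>i\<in>UNIV. (((y - c) \<bullet> u i) / a i) *\<^sub>R u i)"
    have "(norm x)\<^sup>2 \<le> 1"
      using y by (simp add: x_def orthonormal_family_norm_sum[OF u] axes_ellipsoid_def)
    moreover have "A *v x = y - c"
      using orthonormal_family_expand[OF u, of "y - c"]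
      by (simp add: A x_def orthonormal_family_inner_sum[OF u] a0)
    ultimately show "y \<in> (\<lambda>x. A *v x + c) ` cball 0 1"
      by (intro image_eqI[of _ _ x]) (auto simp: le1)
  qed
qed

text \<open>A reflection in an axis only changes signs of the coordinates of \<open>x - c\<close>,
  which enter the defining inequality squared. Being an involution, it maps the ellipsoid onto
  itself and not merely into itself.\<close>

lemma principal_axes_axes_ellipsoid:
  assumes u: "orthonormal_family u"
  shows "principal_axes (axes_ellipsoid c u a) c u"
proof -
  have "reflect_axis c (u i) ` axes_ellipsoid c u a = axes_ellipsoid c u a" for i
  proof -
    have "((reflect_axis c (u i) x - c) \<bullet> u j)\<^sup>2 = ((x - c) \<bullet> u j)\<^sup>2" for x j
      using u by (cases "i = j") (simp_all add: power2_commute reflect_axis_def inner_add_left inner_diff_left orthonormal_family_def)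
    then have mem: "reflect_axis c (u i) x \<in> axes_ellipsoid c u a" if "x \<in> axes_ellipsoid c u a" for x
      using that by (simp add: axes_ellipsoid_def power_divide)
    have inv: "reflect_axis c (u i) (reflect_axis c (u i) x) = x" for x
      using u by (simp add: reflect_axis_def orthonormal_family_def algebra_simps inner_diff_left inner_add_left)
    show ?thesis using mem inv by (metis (no_types, lifting) image_subsetI image_eqI subsetI subset_antisym)
  qed
  then show ?thesis
    using u by (auto simp: principal_axes_def axis_of_symmetry_def orthonormal_family_def norm_eq_1)
qed

lemma axis_length_axes_ellipsoid:
  assumes u: "orthonormal_family u" and a: "a i > 0"
  shows "axis_length (axes_ellipsoid c u a) c (u i) = 2 * a i"
proof -
  have eq: "axes_ellipsoid c u a \<inter> axis_line c (u i) = (\<lambda>t. c + t *\<^sub>R u i) ` {- a i..a i}"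
  proof -
    have "c + t *\<^sub>R u i \<in> axes_ellipsoid c u a \<longleftrightarrow> t \<in> {- a i..a i}" for t
    proof -
      have "(\<Sum>j\<in>UNIV. (t * (u i \<bullet> u j) / a j)\<^sup>2) = (\<Sum>j\<in>UNIV. if i = j then (t / a j)\<^sup>2 else 0)"
        using u by (intro sum.cong) (auto simp: orthonormal_family_def)
      then have "c + t *\<^sub>R u i \<in> axes_ellipsoid c u a \<longleftrightarrow> (t / a i)\<^sup>2 \<le> 1"
        by (simp add: axes_ellipsoid_def)
      also have "\<dots> \<longleftrightarrow> \<bar>t\<bar> \<le> a i"
        using a by (simp add: abs_square_le_1)
      finally show ?thesis by auto
    qed
    then show ?thesis unfolding axis_line_def by blast
  qed
  have nu: "norm (u i) = 1"
    using u by (simp add: orthonormal_family_def norm_eq_1)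
  have "diameter ((\<lambda>t. c + t *\<^sub>R u i) ` {- a i..a i}) = 2 * a i"
  proof (rule antisym)
    show "diameter ((\<lambda>t. c + t *\<^sub>R u i) ` {- a i..a i}) \<le> 2 * a i"
      using a by (intro diameter_le) (auto simp: nu simp flip: scaleR_diff_left)
    have "compact ((\<lambda>t. c + t *\<^sub>R u i) ` {- a i..a i})"
      by (intro compact_continuous_image continuous_intros) auto
    then have "dist (c + a i *\<^sub>R u i) (c + (- a i) *\<^sub>R u i)
        \<le> diameter ((\<lambda>t. c + t *\<^sub>R u i) ` {- a i..a i})"
      using a by (intro diameter_bounded_bound compact_imp_bounded imageI) auto
    then show "2 * a i \<le> diameter ((\<lambda>t. c + t *\<^sub>R u i) ` {- a i..a i})"
      using a by (simp add: dist_norm nu flip: scaleR_add_left)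
  qed
  then show ?thesis by (simp add: axis_length_def eq)
qed

text \<open>The centre of the ellipsoid need not be the given point \<open>c\<close>: in dimension one
  \<open>reflect_axis c u\<close> is the identity. But the centre is fixed by every reflection, so it lies on
  every axis, and moving \<open>c\<close> there changes neither the axes nor the reflections.\<close>

lemma ellipsoid_principal_axes:
  fixes E :: "(real^'n) set"
  assumes E: "ellipsoid E" and pa: "principal_axes E c u"
  obtains c' a where "orthonormal_family u" "\<And>i. a i > 0" "E = axes_ellipsoid c' u a"
    "\<And>i. axis_length E c (u i) = 2 * a i"
proof -
  have u: "orthonormal_family u"
    using pa by (auto simp: principal_axes_def axis_of_symmetry_def orthonormal_family_def norm_eq_1)
  have uu: "u i \<bullet> u i = 1" for i using u by (simp add: orthonormal_family_def)
  obtain A :: "real^'n^'n" and c0 where A: "invertible A" "E = (\<lambda>x. A *v x + c0) ` cball 0 1"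
    using E by (auto simp: ellipsoid_def)
  then obtain B where B: "A ** B = mat 1" "B ** A = mat 1"
    by (auto simp: invertible_def)
  have AB: "A *v (B *v x) = x" and BA: "B *v (A *v x) = x" for x
    using B by (simp_all add: matrix_vector_mul_assoc)
  \<comment> \<open>\<open>E\<close> is the unit ball around \<open>c0\<close> of the norm
    \<open>norm (B *v y)\<close>; the rest of the proof works with this norm.\<close>
  have memE: "x \<in> E \<longleftrightarrow> norm (B *v (x - c0)) \<le> 1" for x
  proof
    assume "norm (B *v (x - c0)) \<le> 1"
    then show "x \<in> E"
      unfolding A(2) by (intro image_eqI[of _ _ "B *v (x - c0)"]) (auto simp: AB)
  qed (auto simp: A(2) BA)
  have B0: "B *v x = 0 \<Longrightarrow> x = 0" for x
    by (metis AB matrix_vector_mult_0_right)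
  define S where "S i y = (2 * (y \<bullet> u i)) *\<^sub>R u i - y" for i and y :: "real^'n"
  have R: "reflect_axis c (u i) x = c + S i (x - c)" for i x
    by (simp add: reflect_axis_def S_def)
  have S_lin: "S i (x + y) = S i x + S i y" "S i (t *\<^sub>R x) = t *\<^sub>R S i x"
    "S i (x - y) = S i x - S i y" for i x y t
    by (simp_all add: S_def inner_add_left inner_diff_left algebra_simps)
  have SS: "S i (S i y) = y" for i y
    by (simp add: S_def inner_diff_left uu)
  have RE: "c + S i (x - c) \<in> E" if "x \<in> E" for i x
    using pa that unfolding principal_axes_def axis_of_symmetry_def R by blast
  have fixed: "S i (c0 - c) = c0 - c" for i
  proof (rule ccontr)
    assume ne: "S i (c0 - c) \<noteq> c0 - c"
    define w where "w = S i (c0 - c) - (c0 - c)"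
    have w: "w \<noteq> 0" using ne by (simp add: w_def)
    have sym: "2 *\<^sub>R c0 - x \<in> E" if "x \<in> E" for x
    proof -
      have "B *v (2 *\<^sub>R c0 - x - c0) = - (B *v (x - c0))"
        by (simp add: scaleR_2 matrix_vector_mult_diff_distrib)
      then show ?thesis using that by (simp add: memE)
    qed
    \<comment> \<open>Composing the point reflections in \<open>c0\<close> and in its mirror image is a translation by \<open>2w\<close>.\<close>
    have shift: "x + 2 *\<^sub>R w \<in> E" if "x \<in> E" for x
    proof -
      have "c + S i (2 *\<^sub>R c0 - (c + S i ((2 *\<^sub>R c0 - x) - c)) - c) \<in> E"
        by (intro RE sym that)
      also have "c + S i (2 *\<^sub>R c0 - (c + S i ((2 *\<^sub>R c0 - x) - c)) - c)
          = c + S i (2 *\<^sub>R (c0 - c)) - ((2 *\<^sub>R c0 - x) - c)"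
      proof -
        have "2 *\<^sub>R c0 - (c + S i ((2 *\<^sub>R c0 - x) - c)) - c
            = 2 *\<^sub>R (c0 - c) - S i ((2 *\<^sub>R c0 - x) - c)"
          by (simp add: algebra_simps scaleR_2)
        then show ?thesis by (simp only: S_lin(3) SS) (simp add: algebra_simps)
      qed
      also have "\<dots> = x + 2 *\<^sub>R w"
        by (simp only: S_lin(2) w_def) (simp add: algebra_simps scaleR_2)
      finally show ?thesis .
    qed
    define n where "n = norm (B *v w)"
    have n: "n > 0" using w B0 by (auto simp: n_def)
    \<comment> \<open>A boundary point in the direction of \<open>w\<close>: the translation by
      \<open>2w\<close> would carry it out of \<open>E\<close>.\<close>
    have "c0 + (1 / n) *\<^sub>R w \<in> E"
      using n by (simp add: memE matrix_vector_mult_scaleR flip: n_def)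
    from shift[OF this] have "norm (B *v ((1 / n + 2) *\<^sub>R w)) \<le> 1"
      by (simp add: memE algebra_simps)
    then have "(1 / n + 2) * n \<le> 1"
      using n by (simp add: matrix_vector_mult_scaleR flip: n_def)
    then show False using n by (simp add: distrib_right)
  qed
  have SE: "norm (B *v S i y) \<le> 1" if "norm (B *v y) \<le> 1" for i y
  proof -
    have "c0 + y \<in> E" using that by (simp add: memE)
    from RE[OF this, of i] have "c + S i ((c0 - c) + y) \<in> E"
      by (simp add: algebra_simps)
    then have "c + ((c0 - c) + S i y) \<in> E"
      by (simp only: S_lin(1) fixed)
    then show ?thesis by (simp add: memE)
  qed
  \<comment> \<open>By homogeneity, preserving the unit ball means not increasing the norm; the
    involution \<open>S i\<close> is then an isometry of it.\<close>
  have Sle: "norm (B *v S i y) \<le> norm (B *v y)" for i y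
  proof (cases "y = 0")
    case False
    define n where "n = norm (B *v y)"
    have n: "n > 0" using False B0 by (auto simp: n_def)
    have "norm (B *v S i ((1 / n) *\<^sub>R y)) \<le> 1"
      using n by (intro SE) (simp add: matrix_vector_mult_scaleR flip: n_def)
    then show ?thesis
      using n by (simp add: S_lin matrix_vector_mult_scaleR field_simps flip: n_def)
  qed (simp add: S_def)
  have Seq: "norm (B *v S i y) = norm (B *v y)" for i y
    using Sle[of i y] Sle[of i "S i y"] by (simp add: SS)
  have orth: "(B *v u i) \<bullet> (B *v u j) = 0" if "i \<noteq> j" for i j
  proof -
    \<comment> \<open>The sum and the difference of \<open>B *v u i\<close> and
      \<open>B *v u j\<close> therefore have equal norms, which by polarisation forces
      orthogonality.\<close>
    have "S i (u i + u j) = u i - u j"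
      using u that by (simp add: S_def inner_add_left orthonormal_family_def scaleR_2)
    then have "norm (B *v u i - B *v u j) = norm (B *v u i + B *v u j)"
      using Seq[of i "u i + u j"]
      by (simp add: matrix_vector_mult_diff_distrib matrix_vector_right_distrib)
    then have "(B *v u i - B *v u j) \<bullet> (B *v u i - B *v u j)
        = (B *v u i + B *v u j) \<bullet> (B *v u i + B *v u j)"
      by (simp add: dot_square_norm)
    then show ?thesis
      by (simp add: inner_add_left inner_add_right inner_diff_left inner_diff_right inner_commute)
  qed
  \<comment> \<open>The semi-axis: \<open>c0\<close> moved by \<open>a i\<close> along
    \<open>u i\<close> lies on the boundary of \<open>E\<close>.\<close>
  define a where "a i = 1 / norm (B *v u i)" for i
  have a: "a i > 0" for i
    using uu[of i] B0[of "u i"] by (auto simp: a_def)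
  have normB: "(norm (B *v y))\<^sup>2 = (\<Sum>i\<in>UNIV. ((y \<bullet> u i) / a i)\<^sup>2)" for y
  proof -
    have "B *v y = B *v (\<Sum>i\<in>UNIV. (y \<bullet> u i) *\<^sub>R u i)"
      by (simp add: orthonormal_family_expand[OF u])
    also have "\<dots> = (\<Sum>i\<in>UNIV. (y \<bullet> u i) *\<^sub>R (B *v u i))"
      by (simp add: linear_sum[OF matrix_vector_mul_linear] matrix_vector_mult_scaleR)
    finally have "(norm (B *v y))\<^sup>2 = (\<Sum>i\<in>UNIV. (norm ((y \<bullet> u i) *\<^sub>R (B *v u i)))\<^sup>2)"
      by (simp only:) (intro norm_sum_Pythagorean, auto simp: pairwise_def orthogonal_def orth)
    then show ?thesis by (simp add: a_def power_mult_distrib)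
  qed
  have EE: "E = axes_ellipsoid c0 u a"
    by (auto simp: memE axes_ellipsoid_def abs_square_le_1 simp flip: normB)
  have line: "axis_line c (u i) = axis_line c0 (u i)" for i
  proof -
    define t where "t = (c0 - c) \<bullet> u i"
    \<comment> \<open>A vector fixed by \<open>S i\<close> equals its own projection onto the line
      spanned by \<open>u i\<close>.\<close>
    have "2 *\<^sub>R (c0 - c) = 2 *\<^sub>R (t *\<^sub>R u i)"
      using fixed[of i] by (simp add: S_def t_def algebra_simps scaleR_2)
    then have "c0 - c = t *\<^sub>R u i" by (rule real_vector.scale_left_imp_eq[rotated]) simp
    then have c0: "c0 = c + t *\<^sub>R u i" by (simp add: algebra_simps)
    have "c + s *\<^sub>R u i = c0 + (s - t) *\<^sub>R u i" "c0 + s *\<^sub>R u i = c + (s + t) *\<^sub>R u i" for s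
      by (simp_all add: c0 algebra_simps)
    then show ?thesis unfolding axis_line_def by blast
  qed
  have "axis_length E c (u i) = 2 * a i" for i
    using axis_length_axes_ellipsoid[OF u a, of c0] unfolding axis_length_def line EE .
  then show ?thesis using that[OF u a EE] by blast
qed

section \<open>Positive definite matrices of fixed trace as parameters of ellipsoids\<close>

text \<open>The sum of the rank-one matrices \<open>u i (u i)^T\<close> weighted by
  \<open>a i\<close>; for an orthonormal family it has eigenvectors \<open>u i\<close> and
  eigenvalues \<open>a i\<close>.\<close>

definition spectral_matrix :: "('n \<Rightarrow> real^'n) \<Rightarrow> ('n \<Rightarrow> real) \<Rightarrow> real^'n^'n" where
  "spectral_matrix u a = (\<chi> j k. \<Sum>i\<in>UNIV. a i * (u i $ j * u i $ k))"

lemma spectral_matrix_mult: "spectral_matrix u a *v x = (\<Sum>i\<in>UNIV. (a i * (x \<bullet> u i)) *\<^sub>R u i)"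
proof -
  have "(spectral_matrix u a *v x) $ j = (\<Sum>i\<in>UNIV. (a i * (x \<bullet> u i)) *\<^sub>R u i) $ j" for j
  proof -
    have "(spectral_matrix u a *v x) $ j = (\<Sum>k\<in>UNIV. \<Sum>i\<in>UNIV. a i * (u i $ j * u i $ k) * x $ k)"
      by (simp add: spectral_matrix_def matrix_vector_mult_def sum_distrib_right)
    also have "\<dots> = (\<Sum>i\<in>UNIV. \<Sum>k\<in>UNIV. a i * (u i $ j * u i $ k) * x $ k)"
      by (rule sum.swap)
    also have "\<dots> = (\<Sum>i\<in>UNIV. (a i * (x \<bullet> u i)) *\<^sub>R u i) $ j"
      by (simp add: inner_vec_def sum_distrib_left sum_distrib_right mult_ac)
    finally show ?thesis .
  qed
  then show ?thesis by (simp add: vec_eq_iff)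
qed

text \<open>For a general invertible matrix the sum of the semi-axes is the sum of the singular
  values; for a positive definite one it is the trace, which is linear.\<close>

definition posdef_params :: "real \<Rightarrow> ((real^'n^'n) \<times> (real^'n)) set" where
  "posdef_params t = {(A, c). transpose A = A \<and> (\<forall>x. x \<noteq> 0 \<longrightarrow> 0 < x \<bullet> (A *v x)) \<and> trace A = t}"

lemma convex_posdef_params: "convex (posdef_params t)"
proof (rule convexI)
  fix p q :: "(real^'n^'n) \<times> (real^'n)" and r s :: real
  assume pq: "p \<in> posdef_params t" "q \<in> posdef_params t" and rs: "0 \<le> r" "0 \<le> s" "r + s = 1"
  obtain A c B d where eq: "p = (A, c)" "q = (B, d)" by (cases p, cases q)
  have "transpose (r *\<^sub>R A + s *\<^sub>R B) = r *\<^sub>R transpose A + s *\<^sub>R transpose B"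
    by (simp add: transpose_def vec_eq_iff)
  moreover have "trace (r *\<^sub>R A + s *\<^sub>R B) = r * trace A + s * trace B"
    by (simp add: trace_def sum.distrib sum_distrib_left)
  moreover have "0 < x \<bullet> ((r *\<^sub>R A + s *\<^sub>R B) *v x)" if "x \<noteq> 0" for x
  proof -
    have "x \<bullet> ((r *\<^sub>R A + s *\<^sub>R B) *v x) = r * (x \<bullet> (A *v x)) + s * (x \<bullet> (B *v x))"
      by (simp add: matrix_vector_mult_add_rdistrib scaleR_matrix_vector_assoc[symmetric] inner_add_right)
    moreover have "0 < x \<bullet> (A *v x)" "0 < x \<bullet> (B *v x)"
      using pq that by (auto simp: posdef_params_def eq)
    \<comment> \<open>One positive weight keeps the inequality strict.\<close>
    moreover have "r > 0 \<or> s > 0" using rs by linarith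
    ultimately show ?thesis
      using rs by (auto intro: add_pos_nonneg add_nonneg_pos)
  qed
  ultimately show "r *\<^sub>R p + s *\<^sub>R q \<in> posdef_params t"
    using pq rs(3) by (simp add: posdef_params_def eq flip: distrib_right)
qed

text \<open>From left to right, the matrix is rebuilt from the axes and semi-axes; from right to
  left, the spectral theorem supplies them. The trace is \<open>s / 2\<close> because axis lengths
  are twice the eigenvalues.\<close>

lemma ellipsoid_axis_length_sum_iff:
  "ellipsoid E \<and> has_axis_length_sum E s \<longleftrightarrow>
    (\<exists>(A, c)\<in>posdef_params (s / 2). E = (\<lambda>x. A *v x + c) ` cball 0 1)"
proof
  assume "ellipsoid E \<and> has_axis_length_sum E s"
  then obtain c u where E: "ellipsoid E" "principal_axes E c u"
    and s: "(\<Sum>i\<in>UNIV. axis_length E c (u i)) = s"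
    by (auto simp: has_axis_length_sum_def)
  obtain c' a where u: "orthonormal_family u" and a: "\<And>i. a i > 0" and EE: "E = axes_ellipsoid c' u a"
    and len: "\<And>i. axis_length E c (u i) = 2 * a i"
    using ellipsoid_principal_axes[OF E] by metis
  let ?A = "spectral_matrix u a"
  have "transpose ?A = ?A"
    by (simp add: spectral_matrix_def transpose_def vec_eq_iff mult_ac)
  moreover have "0 < x \<bullet> (?A *v x)" if "x \<noteq> 0" for x
  proof -
    have "x \<bullet> (?A *v x) = (\<Sum>i\<in>UNIV. a i * (x \<bullet> u i)\<^sup>2)"
      by (simp add: spectral_matrix_mult inner_sum_right power2_eq_square mult_ac)
    moreover have "\<exists>i. x \<bullet> u i \<noteq> 0"
    proof (rule ccontr)
      assume "\<nexists>i. x \<bullet> u i \<noteq> 0"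
      then have "x = 0" using orthonormal_family_expand[OF u, of x] by simp
      with that show False by simp
    qed
    then obtain i where "x \<bullet> u i \<noteq> 0" ..
    ultimately show ?thesis
      using a by (auto intro!: sum_pos2[of _ i] simp: less_imp_le)
  qed
  moreover have "trace ?A = s / 2"
  proof -
    have "trace ?A = (\<Sum>i\<in>UNIV. a i)"
      by (simp add: trace_orthonormal_family[OF u, symmetric] spectral_matrix_mult
          orthonormal_family_inner_sum[OF u])
         (use u in \<open>simp add: orthonormal_family_def\<close>)
    with s show ?thesis by (simp add: len flip: sum_distrib_left)
  qed
  ultimately have "(?A, c') \<in> posdef_params (s / 2)" by (simp add: posdef_params_def)
  moreover have "E = (\<lambda>x. ?A *v x + c') ` cball 0 1"
    unfolding EE by (rule image_cball_eq_axes_ellipsoid[OF u a spectral_matrix_mult, symmetric])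
  ultimately show "\<exists>(A, c)\<in>posdef_params (s / 2). E = (\<lambda>x. A *v x + c) ` cball 0 1" by blast
next
  assume "\<exists>(A, c)\<in>posdef_params (s / 2). E = (\<lambda>x. A *v x + c) ` cball 0 1"
  then obtain A c where A: "transpose A = A" "\<And>x. x \<noteq> 0 \<Longrightarrow> 0 < x \<bullet> (A *v x)" "trace A = s / 2"
    and E: "E = (\<lambda>x. A *v x + c) ` cball 0 1"
    by (auto simp: posdef_params_def)
  obtain u l where u: "orthonormal_family u" and l: "\<And>i. A *v u i = l i *\<^sub>R u i"
    using spectral_theorem_symmetric[OF A(1)] by metis
  have uu: "u i \<bullet> u i = 1" for i using u by (simp add: orthonormal_family_def)
  have pos: "l i > 0" for i
    using A(2)[of "u i"] uu[of i] by (force simp: l)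
  have "A *v x = (\<Sum>i\<in>UNIV. (l i * (x \<bullet> u i)) *\<^sub>R u i)" for x
  proof -
    have "A *v x = A *v (\<Sum>i\<in>UNIV. (x \<bullet> u i) *\<^sub>R u i)"
      by (simp add: orthonormal_family_expand[OF u])
    also have "\<dots> = (\<Sum>i\<in>UNIV. (x \<bullet> u i) *\<^sub>R (A *v u i))"
      by (simp add: linear_sum[OF matrix_vector_mul_linear] matrix_vector_mult_scaleR)
    finally show ?thesis by (simp add: l mult.commute)
  qed
  then have EE: "E = axes_ellipsoid c u l"
    unfolding E by (rule image_cball_eq_axes_ellipsoid[OF u pos])
  have "(\<Sum>i\<in>UNIV. axis_length E c (u i)) = 2 * (\<Sum>i\<in>UNIV. (A *v u i) \<bullet> u i)"
    by (simp add: EE axis_length_axes_ellipsoid[OF u pos] l uu sum_distrib_left)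
  also have "\<dots> = s"
    by (simp add: trace_orthonormal_family[OF u] A(3))
  finally have "has_axis_length_sum E s"
    using principal_axes_axes_ellipsoid[OF u] unfolding has_axis_length_sum_def EE by blast
  moreover have "invertible A"
  proof -
    have "x = 0" if "A *v x = 0" for x
      using A(2)[of x] that by force
    then show ?thesis
      by (metis invertible_left_inverse matrix_left_invertible_ker)
  qed
  ultimately show "ellipsoid E \<and> has_axis_length_sum E s"
    using E by (auto simp: ellipsoid_def)
qed

section \<open>Helly's theorem applied to the parameters of ellipsoids inside each member of the
  family\<close>

theorem theorem2p8:
  fixes F :: "(real^'n) set set"
  assumes "finite F"
    and "\<And>K. K \<in> F \<Longrightarrow> convex K"
    and "\<And>G. G \<subseteq> F \<Longrightarrow> card G \<le> CARD('n) * (CARD('n) + 3) div 2 \<Longrightarrow>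
           \<exists>E. ellipsoid E \<and> has_axis_length_sum E 1 \<and> E \<subseteq> \<Inter>G"
  shows "\<exists>E. ellipsoid E \<and> has_axis_length_sum E 1 \<and> E \<subseteq> \<Inter>F"
proof -
  let ?P = "posdef_params (1 / 2) :: ((real^'n^'n) \<times> (real^'n)) set"
  \<comment> \<open>All affine maps sending the unit ball into \<open>K\<close>. Positivity and
    trace are left to \<open>?P\<close>, so convexity of \<open>C K\<close> rests on that of
    \<open>K\<close> alone.\<close>
  define C where "C K = {(A :: real^'n^'n, c). \<forall>x\<in>cball 0 1. A *v x + c \<in> K}" for K :: "(real^'n) set"
  have iff: "(\<exists>E. ellipsoid E \<and> has_axis_length_sum E 1 \<and> E \<subseteq> \<Inter>G) \<longleftrightarrow>
      (\<exists>p\<in>?P. \<forall>K\<in>G. p \<in> C K)" for G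
  proof -
    have "(\<exists>E. ellipsoid E \<and> has_axis_length_sum E 1 \<and> E \<subseteq> \<Inter>G) \<longleftrightarrow>
        (\<exists>E. (\<exists>(A, c)\<in>?P. E = (\<lambda>x. A *v x + c) ` cball 0 1) \<and> E \<subseteq> \<Inter>G)"
      unfolding ellipsoid_axis_length_sum_iff[symmetric] by simp
    also have "\<dots> \<longleftrightarrow> (\<exists>(A, c)\<in>?P. (\<lambda>x. A *v x + c) ` cball 0 1 \<subseteq> \<Inter>G)" by blast
    also have "\<dots> \<longleftrightarrow> (\<exists>p\<in>?P. \<forall>K\<in>G. p \<in> C K)"
      by (intro bex_cong refl) (auto simp: C_def)
    finally show ?thesis .
  qed
  have "convex (C K)" if "K \<in> F" for K
  proof (rule convexI)
    fix p q and r s :: real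
    assume pq: "p \<in> C K" "q \<in> C K" and rs: "0 \<le> r" "0 \<le> s" "r + s = 1"
    obtain A c B d where eq: "p = (A, c)" "q = (B, d)" by (cases p, cases q)
    have "(r *\<^sub>R A + s *\<^sub>R B) *v x + (r *\<^sub>R c + s *\<^sub>R d) \<in> K" if x: "x \<in> cball 0 1" for x
    proof -
      \<comment> \<open>The combined map sends each \<open>x\<close> to the same convex combination
        of its two images.\<close>
      have "r *\<^sub>R (A *v x + c) + s *\<^sub>R (B *v x + d) \<in> K"
        using pq x by (intro convexD[OF assms(2)[OF \<open>K \<in> F\<close>]] rs) (auto simp: C_def eq)
      then show ?thesis
        by (simp add: matrix_vector_mult_add_rdistrib scaleR_matrix_vector_assoc[symmetric] algebra_simps)
    qed
    then show "r *\<^sub>R p + s *\<^sub>R q \<in> C K" by (simp add: C_def eq)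
  qed
  moreover have "aff_dim ?P < int (CARD('n) * (CARD('n) + 3) div 2)"
  proof -
    \<comment> \<open>The dimension bound comes from the linear constraints, so positivity is
      dropped.\<close>
    have "aff_dim ?P \<le> aff_dim {(A :: real^'n^'n, c :: real^'n). transpose A = A \<and> trace A = 1 / 2}"
      by (intro aff_dim_subset) (auto simp: posdef_params_def)
    then show ?thesis
      using aff_dim_symmetric_trace_less[of "1 / 2", where 'n = 'n] by linarith
  qed
  ultimately have "\<exists>p\<in>?P. \<forall>K\<in>F. p \<in> C K"
    using assms(3) unfolding iff
    by (intro Helly_aff_dim[OF assms(1) convex_posdef_params]) auto
  then show ?thesis unfolding iff .
qed

end
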